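(* For $p\in[1,\infty]$ let $\theta_p=2\arcsin\big(\frac{2\sqrt{p-1}}p\big)$ (with $\theta_\infty=0$). Then, for every $p\in[1,\infty]$, every $n,d\in\mathbb{N}$ with $d\in\{1,\ldots,n\}$ and every function $f:\{-1,1\}^n\to\mathbb{C}$ of degree at most $d$, we have $$\|\Delta f\|_{L_p(\{-1,1\}^n;\mathbb{C})}\leq10\,d^{2-\frac{\theta_p}\pi}\,\|f\|_{L_p(\{-1,1\}^n;\mathbb{C})}.$$
   Context: $\mathbb{N}=\{1,2,\ldots\}$. For $p\in[1,\infty)$, $\|f\|_{L_p(\{-1,1\}^n;\mathbb{C})}=\big(2^{-n}\sum_{\varepsilon\in\{-1,1\}^n}|f(\varepsilon)|^p\big)^{1/p}$, and $\|f\|_{L_\infty(\{-1,1\}^n;\mathbb{C})}=\max_\varepsilon|f(\varepsilon)|$. For $A\subseteq\{1,\ldots,n\}$, the Walsh function is $w_A(\varepsilon)=\prod_{i\in A}\varepsilon_i$. Every $f:\{-1,1\}^n\to\mathbb{C}$ has the expansion $f=\sum_{A}\widehat f(A)w_A$ with $\widehat f(A)=2^{-n}\sum_{\delta\in\{-1,1\}^n}f(\delta)w_A(\delta)$. The hypercube Laplacian is $\Delta f=\sum_A|A|\widehat f(A)w_A$. A function $f$ has degree at most $d$ if $\widehat f(A)=0$ whenever $|A|>d$. *)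

theory Defs
  imports Complex_Main "HOL-Library.FuncSet" "HOL-Library.Extended_Real"
begin

text \<open>Points of the hypercube are extensional functions on \<open>{1..n}\<close>, so that \<open>cube n\<close>
  has exactly \<open>2 ^ n\<close> elements.  A function on the hypercube is a total HOL function of
  which only the values on \<open>cube n\<close> are ever used.\<close>

definition cube :: "nat \<Rightarrow> (nat \<Rightarrow> real) set" where
  "cube n = {1..n} \<rightarrow>\<^sub>E {-1, 1}"

definition cube_norm :: "nat \<Rightarrow> ereal \<Rightarrow> ((nat \<Rightarrow> real) \<Rightarrow> complex) \<Rightarrow> real" where
  "cube_norm n p f =
     (if p = \<infinity> then Max ((\<lambda>\<epsilon>. cmod (f \<epsilon>)) ` cube n)
      else ((\<Sum>\<epsilon>\<in>cube n. cmod (f \<epsilon>) powr real_of_ereal p) / 2 ^ n) powr (1 / real_of_ereal p))"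

definition walsh :: "nat set \<Rightarrow> (nat \<Rightarrow> real) \<Rightarrow> complex" where
  "walsh A \<epsilon> = (\<Prod>i\<in>A. complex_of_real (\<epsilon> i))"

definition walsh_coeff :: "nat \<Rightarrow> ((nat \<Rightarrow> real) \<Rightarrow> complex) \<Rightarrow> nat set \<Rightarrow> complex" where
  "walsh_coeff n f A = (\<Sum>\<delta>\<in>cube n. f \<delta> * walsh A \<delta>) / 2 ^ n"

definition laplacian :: "nat \<Rightarrow> ((nat \<Rightarrow> real) \<Rightarrow> complex) \<Rightarrow> (nat \<Rightarrow> real) \<Rightarrow> complex" where
  "laplacian n f \<epsilon> = (\<Sum>A\<in>Pow {1..n}. of_nat (card A) * walsh_coeff n f A * walsh A \<epsilon>)"

definition degree_at_most :: "nat \<Rightarrow> nat \<Rightarrow> ((nat \<Rightarrow> real) \<Rightarrow> complex) \<Rightarrow> bool" where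
  "degree_at_most n d f \<longleftrightarrow> (\<forall>A. A \<subseteq> {1..n} \<and> card A > d \<longrightarrow> walsh_coeff n f A = 0)"

definition theta :: "ereal \<Rightarrow> real" where
  "theta p =
     (if p = \<infinity> then 0
      else 2 * arcsin (2 * sqrt (real_of_ereal p - 1) / real_of_ereal p))"

end

theory Submission
  imports Defs "HOL-Complex_Analysis.Complex_Analysis" "HOL-Real_Asymp.Real_Asymp"
begin

text \<open>For complex \<open>z\<close> let \<open>T z\<close> be the noise operator, which multiplies the Walsh function
\<open>walsh A\<close> by \<open>z ^ card A\<close>.  If \<open>f\<close> has degree at most \<open>d\<close>, then \<open>z \<mapsto> T z f\<close> is a
polynomial of degree at most \<open>d\<close> with \<open>T 1 f = f\<close>, and its derivative at \<open>z = 1\<close> is the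
Laplacian of \<open>f\<close>.  So the theorem is an inequality of Markov type for a polynomial that is
known to be bounded on the set of all \<open>z\<close> for which \<open>T z\<close> is a contraction of \<open>L\<^sub>p\<close>.

That set contains a lens with a corner at \<open>1\<close>.  Let \<open>\<phi>\<close> be half of \<open>theta p\<close>, so that
\<open>cos \<phi> = \<bar>p - 2\<bar> / p\<close>.  The operator \<open>T z\<close> is a product of commuting operators, one for each
coordinate, so by Fubini the contraction property only has to be checked for \<open>n = 1\<close>.
There the operator with \<open>z = 1 / (1 + \<mu>)\<close> is the resolvent of \<open>\<mu>\<close> times the one-dimensional
Laplacian, and a resolvent is a contraction as soon as the operator is accretive.
Accretivity on \<open>L\<^sub>p\<close> for all \<open>\<mu>\<close> with \<open>\<bar>arg \<mu>\<bar> \<le> \<phi>\<close> is \<open>sectoriality\<close>, which comes down to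
the monotonicity of \<open>sinh x / x\<close> when \<open>1 < p < \<infinity>\<close>; for \<open>p = 1\<close> and \<open>p = \<infinity>\<close> one has
\<open>\<phi> = 0\<close> and \<open>T z\<close> is an average.  The image of this sector under \<open>\<mu> \<mapsto> 1 / (1 + \<mu>)\<close> is a
lens with corners \<open>0\<close> and \<open>1\<close> and with angle \<open>theta p\<close> at each of them.

Near a corner the complement of the lens has the angle \<open>2 * pi - theta p = \<beta> * pi\<close> with
\<open>\<beta> = 2 - theta p / pi\<close>.  In the coordinate \<open>w = - \<mu>\<close> this complement is the sector
\<open>\<bar>arg w\<bar> < \<beta> * pi / 2\<close>, which \<open>\<xi> = w powr (1 / \<beta>)\<close> maps onto the right half-plane; the
point \<open>z = \<infinity>\<close> goes to \<open>\<xi> = 1\<close>.  The maximum principle then bounds a polynomial of degree \<open>d\<close>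
outside the lens by the factor \<open>(\<bar>\<xi> + 1\<bar> / \<bar>\<xi> - 1\<bar>) ^ d\<close>
(\<open>bernstein_walsh_sector_complement\<close>).  On the circle \<open>\<bar>w\<bar> = d powr (- \<beta>)\<close> one has
\<open>\<bar>\<xi>\<bar> = 1 / d\<close> wherever that bound is used, so the factor is at most \<open>9\<close>, and Cauchy's
estimate gives the derivative at the corner with the constant \<open>9 * d powr \<beta>\<close> for \<open>d \<ge> 2\<close>
(\<open>markov_lens_corner\<close>).  The passage from scalar polynomials to \<open>L\<^sub>p\<close> norms is by duality.\<close>

section \<open>One-variable inequalities\<close>

lemma Young_powr:
  fixes a b p :: real
  assumes "p \<ge> 1" "a \<ge> 0" "b \<ge> 0"
  shows "a * b powr (p - 1) \<le> a powr p / p + (1 - 1 / p) * b powr p"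
proof (cases "p = 1")
  case True
  then show ?thesis using assms by simp
next
  case False
  then have p: "p > 1" using assms by simp
  define q where "q = p / (p - 1)"
  have "a * b powr (p - 1) \<le> a powr p / p + (b powr (p - 1)) powr q / q"
    using p assms by (intro Youngs_inequality) (auto simp: q_def field_simps)
  also have "(b powr (p - 1)) powr q / q = (1 - 1 / p) * b powr p"
  proof -
    have "(p - 1) * q = p" "1 / q = 1 - 1 / p" using p by (auto simp: q_def field_simps)
    then show ?thesis by (simp add: powr_powr divide_inverse mult.commute)
  qed
  finally show ?thesis .
qed

lemma Holder_sum:
  fixes a b :: "'a \<Rightarrow> real"
  assumes p: "p \<ge> 1" and I: "finite I" and a: "\<And>i. i \<in> I \<Longrightarrow> a i \<ge> 0" and b: "\<And>i. i \<in> I \<Longrightarrow> b i \<ge> 0"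
  shows "(\<Sum>i\<in>I. a i * b i powr (p - 1))
       \<le> (\<Sum>i\<in>I. a i powr p) powr (1 / p) * (\<Sum>i\<in>I. b i powr p) powr (1 - 1 / p)"
proof -
  define A B where "A = (\<Sum>i\<in>I. a i powr p)" and "B = (\<Sum>i\<in>I. b i powr p)"
  have "A \<ge> 0" "B \<ge> 0" by (simp_all add: A_def B_def sum_nonneg)
  show ?thesis
  proof (cases "A = 0 \<or> B = 0")
    case True
    then have "(\<forall>i\<in>I. a i = 0) \<or> (\<forall>i\<in>I. b i = 0)"
      using I by (auto simp: A_def B_def sum_nonneg_eq_0_iff)
    then have "(\<Sum>i\<in>I. a i * b i powr (p - 1)) = 0" by (auto intro: sum.neutral)
    then show ?thesis by (simp add: sum_nonneg)
  next
    case False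
    with \<open>A \<ge> 0\<close> \<open>B \<ge> 0\<close> have pos: "A > 0" "B > 0" by auto
    \<comment> \<open>Normalise both functions to norm one and sum Young's inequality.\<close>
    define \<alpha> \<gamma> where "\<alpha> = A powr (1 / p)" and "\<gamma> = B powr (1 / p)"
    have ag: "\<alpha> > 0" "\<gamma> > 0" "\<alpha> powr p = A" "\<gamma> powr p = B"
      using pos p by (simp_all add: \<alpha>_def \<gamma>_def powr_powr)
    have g: "\<gamma> powr (p - 1) = B powr (1 - 1 / p)"
      using p by (simp add: \<gamma>_def powr_powr diff_divide_distrib right_diff_distrib)
    have "(\<Sum>i\<in>I. a i * b i powr (p - 1)) / (\<alpha> * \<gamma> powr (p - 1))
        = (\<Sum>i\<in>I. a i / \<alpha> * (b i / \<gamma>) powr (p - 1))"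
      unfolding sum_divide_distrib using b ag by (intro sum.cong) (auto simp: powr_divide)
    also have "\<dots> \<le> (\<Sum>i\<in>I. (a i / \<alpha>) powr p / p + (1 - 1 / p) * (b i / \<gamma>) powr p)"
      using p a b ag by (intro sum_mono Young_powr) auto
    also have "\<dots> = (\<Sum>i\<in>I. a i powr p / A / p + (1 - 1 / p) * (b i powr p / B))"
      using a b ag by (intro sum.cong) (auto simp: powr_divide)
    also have "\<dots> = (\<Sum>i\<in>I. a i powr p) / A / p + (1 - 1 / p) * ((\<Sum>i\<in>I. b i powr p) / B)"
      by (simp add: sum.distrib sum_divide_distrib sum_distrib_left)
    also have "\<dots> = 1" using pos unfolding A_def[symmetric] B_def[symmetric] by simp
    finally have "(\<Sum>i\<in>I. a i * b i powr (p - 1)) \<le> \<alpha> * \<gamma> powr (p - 1)"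
      using ag by (simp add: pos_divide_le_eq)
    then show ?thesis
      unfolding g A_def[symmetric] B_def[symmetric] \<alpha>_def[symmetric] .
  qed
qed

section \<open>The two-point inequality\<close>

text \<open>This is the monotonicity of \<open>sinh x / x\<close> on the positive axis, written without quotients.\<close>

lemma sinh_ratio_mono:
  fixes q p v :: real
  assumes "0 \<le> q" "q \<le> p" "0 \<le> v"
  shows "p * sinh (q * v) \<le> q * sinh (p * v)"
proof -
  have "q * sinh (p * 0) - p * sinh (q * 0) \<le> q * sinh (p * v) - p * sinh (q * v)"
  proof (rule DERIV_nonneg_imp_nondecreasing[where f = "\<lambda>v. q * sinh (p * v) - p * sinh (q * v)"])
    fix x assume x: "0 \<le> x" "x \<le> v"
    have "((\<lambda>v. q * sinh (p * v) - p * sinh (q * v)) has_real_derivative p * q * (cosh (p * x) - cosh (q * x))) (at x)"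
      by (rule derivative_eq_intros refl | simp add: algebra_simps)+
    moreover have "cosh (q * x) \<le> cosh (p * x)"
      using x assms by (subst cosh_real_nonneg_le_iff) (auto intro: mult_right_mono)
    then have "0 \<le> p * q * (cosh (p * x) - cosh (q * x))"
      using assms by simp
    ultimately show "\<exists>y. ((\<lambda>v. q * sinh (p * v) - p * sinh (q * v)) has_real_derivative y) (at x) \<and> 0 \<le> y"
      by blast
  qed (use assms in auto)
  then show ?thesis by simp
qed

lemma sinh_abs_le:
  fixes p c v :: real
  assumes p: "1 < p" and c: "\<bar>p - 2\<bar> / p \<le> c"
  shows "(sinh ((p - 2) * v))\<^sup>2 \<le> c\<^sup>2 * (sinh (p * v))\<^sup>2"
proof -
  have "p * \<bar>sinh ((p - 2) * v)\<bar> = p * sinh (\<bar>p - 2\<bar> * \<bar>v\<bar>)"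
    by (simp add: sinh_real_abs abs_mult flip: abs_mult)
  also have "\<dots> \<le> \<bar>p - 2\<bar> * sinh (p * \<bar>v\<bar>)"
    using p by (intro sinh_ratio_mono) auto
  also have "\<dots> \<le> (p * c) * sinh (p * \<bar>v\<bar>)"
    using p c by (intro mult_right_mono) (auto simp: field_simps)
  finally have "\<bar>sinh ((p - 2) * v)\<bar> \<le> c * sinh (p * \<bar>v\<bar>)"
    using p by simp
  then have "\<bar>sinh ((p - 2) * v)\<bar>\<^sup>2 \<le> (c * sinh (p * \<bar>v\<bar>))\<^sup>2"
    by (intro power_mono) auto
  moreover have "(sinh (p * \<bar>v\<bar>))\<^sup>2 = (sinh (p * v))\<^sup>2"
    by (cases "v \<ge> 0") auto
  ultimately show ?thesis by (simp add: power_mult_distrib)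
qed

text \<open>The duality map of \<open>L\<^sub>p\<close>, up to normalisation: pairing \<open>x\<close> with \<open>conj_power p x\<close> gives
\<open>\<bar>x\<bar> powr p\<close>, and the modulus \<open>\<bar>x\<bar> powr (p - 1)\<close> is the equality case of Hoelder's
inequality.  It is used for accretivity as well as for the final duality argument.\<close>

definition conj_power :: "real \<Rightarrow> complex \<Rightarrow> complex" where
  "conj_power p x = cnj x * of_real (cmod x powr (p - 2))"

lemma cmod_conj_power: "cmod (conj_power p x) = cmod x powr (p - 1)"
  using powr_mult_base[of "cmod x" "p - 2"] by (simp add: conj_power_def norm_mult)

lemma mult_conj_power: "x * conj_power p x = of_real (cmod x powr p)"
proof -
  have "x * conj_power p x = (x * cnj x) * of_real (cmod x powr (p - 2))"
    by (simp add: conj_power_def)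
  also have "\<dots> = of_real (cmod x * (cmod x * cmod x powr (p - 2)))"
    unfolding complex_norm_square[symmetric] by (simp add: power2_eq_square)
  also have "cmod x * (cmod x * cmod x powr (p - 2)) = cmod x powr p"
    by (simp add: powr_mult_base)
  finally show ?thesis .
qed

text \<open>With \<open>C + \<i> E = x * cnj y\<close>, \<open>r = \<bar>x\<bar>\<close> and \<open>s = \<bar>y\<bar>\<close> this is the statement of
\<open>sectoriality\<close> below in real coordinates.  By Cauchy-Schwarz in \<open>(C, E)\<close> only the moduli
matter.  Writing \<open>r = exp (a + v)\<close> and \<open>s = exp (a - v)\<close>, everything becomes
\<open>sinh ((p - 2) v)\<^sup>2 \<le> (cos \<psi>)\<^sup>2 * sinh (p v)\<^sup>2\<close>, which is where the condition
\<open>\<bar>p - 2\<bar> / p \<le> cos \<psi>\<close> enters.\<close>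

lemma sectoriality_real:
  fixes p r s \<psi> C E :: real
  assumes p: "1 < p" and psi: "\<bar>p - 2\<bar> / p \<le> cos \<psi>" and rs: "r > 0" "s > 0"
    and CE: "C\<^sup>2 + E\<^sup>2 = (r * s)\<^sup>2"
  shows "cos \<psi> * ((r powr (p - 2) + s powr (p - 2)) * C) + sin \<psi> * ((r powr (p - 2) - s powr (p - 2)) * E)
       \<le> cos \<psi> * (r powr p + s powr p)"
proof -
  define a v where "a = (ln r + ln s) / 2" and "v = (ln r - ln s) / 2"
  have r: "r = exp (a + v)" and s: "s = exp (a - v)"
    using rs by (simp_all add: a_def v_def field_simps)
  define \<alpha> \<gamma> where "\<alpha> = r powr (p - 2)" and "\<gamma> = s powr (p - 2)"
  have cos0: "cos \<psi> \<ge> 0" using psi p by (smt (verit) divide_nonneg_pos abs_ge_zero)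
  have A: "r * s * \<alpha> = exp (p * a) * exp ((p - 2) * v)" "r * s * \<gamma> = exp (p * a) * exp (- ((p - 2) * v))"
    by (simp_all add: \<alpha>_def \<gamma>_def r s powr_def algebra_simps flip: exp_add)
  have plus: "r * s * (\<alpha> + \<gamma>) = 2 * exp (p * a) * cosh ((p - 2) * v)"
    unfolding distrib_left A cosh_field_def by (simp add: algebra_simps)
  have minus: "r * s * (\<alpha> - \<gamma>) = 2 * exp (p * a) * sinh ((p - 2) * v)"
    unfolding right_diff_distrib A sinh_field_def by (simp add: algebra_simps)
  have R: "r powr p + s powr p = 2 * exp (p * a) * cosh (p * v)"
    unfolding cosh_field_def r s by (simp add: powr_def algebra_simps flip: exp_add)
  let ?L = "cos \<psi> * ((\<alpha> + \<gamma>) * C) + sin \<psi> * ((\<alpha> - \<gamma>) * E)"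
  have "?L\<^sup>2 \<le> ((cos \<psi> * (\<alpha> + \<gamma>))\<^sup>2 + (sin \<psi> * (\<alpha> - \<gamma>))\<^sup>2) * (C\<^sup>2 + E\<^sup>2)"
  proof -
    have "((cos \<psi> * (\<alpha> + \<gamma>))\<^sup>2 + (sin \<psi> * (\<alpha> - \<gamma>))\<^sup>2) * (C\<^sup>2 + E\<^sup>2) - ?L\<^sup>2
        = (cos \<psi> * (\<alpha> + \<gamma>) * E - sin \<psi> * (\<alpha> - \<gamma>) * C)\<^sup>2"
      by (simp add: power2_eq_square algebra_simps)
    then show ?thesis by (smt (verit) zero_le_power2)
  qed
  also have "\<dots> = (cos \<psi>)\<^sup>2 * (r * s * (\<alpha> + \<gamma>))\<^sup>2 + (sin \<psi>)\<^sup>2 * (r * s * (\<alpha> - \<gamma>))\<^sup>2"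
    unfolding CE by (simp add: power2_eq_square algebra_simps)
  also have "\<dots> = (2 * exp (p * a))\<^sup>2 * ((cos \<psi>)\<^sup>2 + (sinh ((p - 2) * v))\<^sup>2)"
  proof -
    have "(cos \<psi>)\<^sup>2 * (cosh ((p - 2) * v))\<^sup>2 + (sin \<psi>)\<^sup>2 * (sinh ((p - 2) * v))\<^sup>2
       = (cos \<psi>)\<^sup>2 + (sinh ((p - 2) * v))\<^sup>2"
      unfolding cosh_square_eq sin_squared_eq by (simp add: algebra_simps)
    from this[symmetric] show ?thesis
      unfolding plus minus by (simp only: power_mult_distrib distrib_left mult_ac)
  qed
  also have "\<dots> \<le> (2 * exp (p * a))\<^sup>2 * ((cos \<psi>)\<^sup>2 + (cos \<psi>)\<^sup>2 * (sinh (p * v))\<^sup>2)"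
    using sinh_abs_le[OF p psi, of v] by (intro mult_left_mono) auto
  also have "\<dots> = (cos \<psi> * (r powr p + s powr p))\<^sup>2"
    unfolding R by (simp add: power_mult_distrib cosh_square_eq algebra_simps)
  finally show ?thesis
    unfolding \<alpha>_def[symmetric] \<gamma>_def[symmetric]
    by (rule power2_le_imp_le) (use cos0 in auto)
qed

text \<open>The numerical range in \<open>L\<^sub>p\<close> of the Laplacian on two points lies in a sector around the positive
axis, of half-angle \<open>pi / 2 - \<phi>\<close> where \<open>cos \<phi> = \<bar>p - 2\<bar> / p\<close>.  Hence rotating it by an
angle of at most \<open>\<phi>\<close> keeps it in the right half-plane.\<close>

lemma sectoriality:
  fixes x y :: complex
  assumes p: "1 < p" and psi: "\<bar>p - 2\<bar> / p \<le> cos \<psi>"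
  shows "0 \<le> Re (cis \<psi> * ((x - y) * (conj_power p x - conj_power p y)))"
proof -
  have cos0: "cos \<psi> \<ge> 0" using psi p by (smt (verit) divide_nonneg_pos abs_ge_zero)
  show ?thesis
  proof (cases "x = 0 \<or> y = 0")
    case True
    then have "(x - y) * (conj_power p x - conj_power p y) = of_real (cmod x powr p + cmod y powr p)"
      by (auto simp: mult_conj_power conj_power_def[of _ 0])
    then show ?thesis using cos0 by simp
  next
    case False
    define C E where "C = Re (x * cnj y)" and "E = Im (x * cnj y)"
    have "C\<^sup>2 + E\<^sup>2 = (cmod (x * cnj y))\<^sup>2"
      unfolding C_def E_def cmod_power2 ..
    then have CE: "C\<^sup>2 + E\<^sup>2 = (cmod x * cmod y)\<^sup>2" by (simp add: norm_mult)
    have c: "x * cnj y = Complex C E" "y * cnj x = Complex C (- E)"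
      by (simp_all add: C_def E_def complex_eq_iff algebra_simps)
    have eq: "(x - y) * (conj_power p x - conj_power p y)
        = of_real (cmod x powr p + cmod y powr p)
        - (of_real (cmod x powr (p - 2)) * (y * cnj x) + of_real (cmod y powr (p - 2)) * (x * cnj y))"
    proof -
      have "(x - y) * (conj_power p x - conj_power p y)
          = x * conj_power p x + y * conj_power p y - (y * conj_power p x + x * conj_power p y)"
        by (simp add: algebra_simps)
      then show ?thesis
        unfolding mult_conj_power by (simp add: conj_power_def mult_ac)
    qed
    have "Re (cis \<psi> * ((x - y) * (conj_power p x - conj_power p y)))
        = cos \<psi> * (cmod x powr p + cmod y powr p)
        - (cos \<psi> * ((cmod x powr (p - 2) + cmod y powr (p - 2)) * C) + sin \<psi> * ((cmod x powr (p - 2) - cmod y powr (p - 2)) * E))"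
      unfolding eq c by (simp add: algebra_simps)
    then show ?thesis
      using sectoriality_real[OF p psi _ _ CE] False by simp
  qed
qed

text \<open>For \<open>z = 1 / (1 + \<mu>)\<close> the output \<open>(x, y)\<close> of the one-coordinate noise operator solves
\<open>u = x + \<mu> * (x - y) / 2\<close> and \<open>v = y - \<mu> * (x - y) / 2\<close>.  Pairing this resolvent equation with
the duality map of \<open>(x, y)\<close>, the term with \<open>\<mu>\<close> has nonnegative real part by \<open>sectoriality\<close>,
and Young's inequality absorbs the rest.\<close>

lemma two_point_contraction:
  fixes u v z :: complex
  assumes p: "1 < p" and psi: "\<bar>p - 2\<bar> / p \<le> cos \<psi>" and rho: "\<rho> \<ge> 0"
    and z: "z = 1 / (1 + rcis \<rho> \<psi>)"
  shows "cmod ((1 + z) / 2 * u + (1 - z) / 2 * v) powr p + cmod ((1 + z) / 2 * v + (1 - z) / 2 * u) powr p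
       \<le> cmod u powr p + cmod v powr p"
proof -
  define \<mu> where "\<mu> = rcis \<rho> \<psi>"
  have "cos \<psi> \<ge> 0" using psi p by (smt (verit) divide_nonneg_pos abs_ge_zero)
  then have "Re \<mu> \<ge> 0" using rho by (simp add: \<mu>_def)
  then have nz: "1 + \<mu> \<noteq> 0" by (auto simp: complex_eq_iff)
  define x y where "x = (1 + z) / 2 * u + (1 - z) / 2 * v" and "y = (1 + z) / 2 * v + (1 - z) / 2 * u"
  have zm: "z * (1 + \<mu>) = 1" using z nz by (simp add: \<mu>_def)
  have "x - y = z * (u - v)" by (simp add: x_def y_def field_simps)
  then have "\<mu> / 2 * (x - y) = (z * (1 + \<mu>) - z) * (u - v) / 2"
    by (simp only:) (simp add: algebra_simps)
  then have mxy: "\<mu> / 2 * (x - y) = (1 - z) * (u - v) / 2" by (simp add: zm)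
  have u: "u = x + \<mu> / 2 * (x - y)" and v: "v = y - \<mu> / 2 * (x - y)"
    unfolding mxy unfolding x_def y_def by (simp_all add: field_simps)
  define W where "W = cis \<psi> * ((x - y) * (conj_power p x - conj_power p y))"
  have "u * conj_power p x + v * conj_power p y
      = of_real (cmod x powr p + cmod y powr p) + \<mu> / 2 * ((x - y) * (conj_power p x - conj_power p y))"
    unfolding u v by (simp add: mult_conj_power[symmetric] add_divide_distrib diff_divide_distrib algebra_simps)
  also have "\<mu> / 2 * ((x - y) * (conj_power p x - conj_power p y)) = of_real (\<rho> / 2) * W"
    by (simp add: \<mu>_def rcis_def W_def mult_ac)
  finally have "Re (u * conj_power p x + v * conj_power p y)
      = cmod x powr p + cmod y powr p + \<rho> / 2 * Re W"
    by simp
  then have "cmod x powr p + cmod y powr p \<le> Re (u * conj_power p x + v * conj_power p y)"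
    using sectoriality[OF p psi, of x y] rho by (simp add: W_def)
  also have "\<dots> \<le> cmod (u * conj_power p x) + cmod (v * conj_power p y)"
    using complex_Re_le_cmod norm_triangle_le order_trans by blast
  also have "\<dots> \<le> (cmod u powr p / p + (1 - 1 / p) * cmod x powr p) + (cmod v powr p / p + (1 - 1 / p) * cmod y powr p)"
    unfolding norm_mult cmod_conj_power using p by (intro add_mono Young_powr) auto
  finally have "(cmod x powr p + cmod y powr p) / p \<le> (cmod u powr p + cmod v powr p) / p"
    using p by (simp add: field_simps)
  then show ?thesis using p by (simp add: x_def y_def divide_le_cancel)
qed

text \<open>The admissible half-angle in terms of \<open>arcsin\<close>, using
\<open>1 - (2 * sqrt (p - 1) / p)\<^sup>2 = ((p - 2) / p)\<^sup>2\<close>.  For \<open>p = 1\<close> the lens degenerates to the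
real segment from \<open>0\<close> to \<open>1\<close>, on which the operator averages \<open>u\<close> and \<open>v\<close> and the triangle
inequality suffices.\<close>

lemma two_point_contraction_lens:
  fixes u v :: complex
  assumes p: "1 \<le> p" and psi: "\<bar>\<psi>\<bar> \<le> arcsin (2 * sqrt (p - 1) / p)" and rho: "\<rho> \<ge> 0"
    and z: "z = 1 / (1 + rcis \<rho> \<psi>)"
  shows "cmod ((1 + z) / 2 * u + (1 - z) / 2 * v) powr p + cmod ((1 + z) / 2 * v + (1 - z) / 2 * u) powr p
       \<le> cmod u powr p + cmod v powr p"
proof (cases "p = 1")
  case True
  then have "\<psi> = 0" using psi by simp
  define t where "t = 1 / (1 + \<rho>)"
  have zt: "z = of_real t" using z \<open>\<psi> = 0\<close> by (simp add: t_def rcis_def)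
  have t: "0 \<le> t" "t \<le> 1" using rho by (auto simp: t_def)
  have *: "cmod ((1 + z) / 2 * u + (1 - z) / 2 * v) \<le> (1 + t) / 2 * cmod u + (1 - t) / 2 * cmod v" for u v
  proof -
    have "cmod ((1 + z) / 2) = (1 + t) / 2" "cmod ((1 - z) / 2) = (1 - t) / 2"
      using t norm_of_real[of "(1 + t) / 2", where 'a = complex] norm_of_real[of "(1 - t) / 2", where 'a = complex]
      by (simp_all add: zt)
    then show ?thesis by (intro norm_triangle_le) (simp only: norm_mult order_refl)
  qed
  show ?thesis
    using *[of u v] *[of v u] True by (simp add: field_simps)
next
  case False
  then have p1: "1 < p" using p by simp
  define x where "x = 2 * sqrt (p - 1) / p"
  have x2: "1 - x\<^sup>2 = ((p - 2) / p)\<^sup>2"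
    using p1 by (simp add: x_def power_divide power_mult_distrib field_simps) (simp add: power2_eq_square algebra_simps)
  have x0: "0 \<le> x" using p1 by (simp add: x_def)
  have "x\<^sup>2 \<le> 1" using x2 by (smt (verit) zero_le_power2)
  then have x1: "x \<le> 1" using x0 by (simp add: power2_le_iff_abs_le abs_square_le_1)
  have "\<bar>p - 2\<bar> / p = cos (arcsin x)"
    using x0 x1 p1 by (simp add: cos_arcsin x2 abs_divide)
  also have "\<dots> \<le> cos \<bar>\<psi>\<bar>"
    using psi arcsin_ubound[of x] x0 x1 by (intro cos_monotone_0_pi_le) (auto simp: x_def)
  finally show ?thesis
    by (intro two_point_contraction[OF p1 _ rho z]) simp
qed

section \<open>The noise operator on the cube\<close>

lemma finite_cube [simp]: "finite (cube n)"
  unfolding cube_def by (intro finite_PiE) auto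

lemma cube_nonempty [simp]: "cube n \<noteq> {}"
  unfolding cube_def by (simp add: PiE_eq_empty_iff)

definition flip :: "nat \<Rightarrow> (nat \<Rightarrow> real) \<Rightarrow> nat \<Rightarrow> real" where
  "flip i \<epsilon> = \<epsilon>(i := - \<epsilon> i)"

lemma flip_flip [simp]: "flip i (flip i \<epsilon>) = \<epsilon>"
  by (auto simp: flip_def)

lemma flip_in_cube: "i \<in> {1..n} \<Longrightarrow> \<epsilon> \<in> cube n \<Longrightarrow> flip i \<epsilon> \<in> cube n"
  by (auto simp: flip_def cube_def PiE_iff extensional_def)

lemma sum_cube_flip:
  "i \<in> {1..n} \<Longrightarrow> (\<Sum>\<epsilon>\<in>cube n. g (flip i \<epsilon>)) = (\<Sum>\<epsilon>\<in>cube n. g \<epsilon>)"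
  by (rule sum.reindex_bij_witness[of _ "flip i" "flip i"]) (auto simp: flip_in_cube)

lemma walsh_flip:
  assumes "finite A"
  shows "walsh A (flip i \<epsilon>) = (if i \<in> A then - walsh A \<epsilon> else walsh A \<epsilon>)"
proof (cases "i \<in> A")
  case True
  have "(\<Prod>j\<in>A - {i}. complex_of_real (flip i \<epsilon> j)) = (\<Prod>j\<in>A - {i}. complex_of_real (\<epsilon> j))"
    by (rule prod.cong) (auto simp: flip_def)
  then show ?thesis
    using True assms by (simp add: walsh_def prod.remove[of A i] flip_def)
next
  case False
  have "(\<Prod>j\<in>A. complex_of_real (flip i \<epsilon> j)) = (\<Prod>j\<in>A. complex_of_real (\<epsilon> j))"
    by (rule prod.cong) (use False in \<open>auto simp: flip_def\<close>)
  then show ?thesis using False by (simp add: walsh_def)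
qed

text \<open>The noise operator acting only in the coordinates of \<open>S\<close>.  The set \<open>S\<close> is a parameter so that
the coordinates can be switched on one at a time; \<open>S = {1..n}\<close> is the full operator.\<close>

definition noise :: "nat \<Rightarrow> nat set \<Rightarrow> complex \<Rightarrow> ((nat \<Rightarrow> real) \<Rightarrow> complex) \<Rightarrow> (nat \<Rightarrow> real) \<Rightarrow> complex" where
  "noise n S z f \<epsilon> = (\<Sum>A\<in>Pow {1..n}. z ^ card (A \<inter> S) * walsh_coeff n f A * walsh A \<epsilon>)"

text \<open>Each coordinate contributes one two-point operator: flipping \<open>i\<close> changes the sign of exactly
those Walsh functions whose index set contains \<open>i\<close>.\<close>

lemma noise_insert:
  assumes "finite S" "i \<notin> S"
  shows "noise n (insert i S) z f \<epsilon>
       = (1 + z) / 2 * noise n S z f \<epsilon> + (1 - z) / 2 * noise n S z f (flip i \<epsilon>)"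
  unfolding noise_def sum_distrib_left sum.distrib[symmetric]
proof (rule sum.cong[OF refl])
  fix A assume "A \<in> Pow {1..n}"
  then have A: "finite A" using finite_subset by auto
  show "z ^ card (A \<inter> insert i S) * walsh_coeff n f A * walsh A \<epsilon>
      = (1 + z) / 2 * (z ^ card (A \<inter> S) * walsh_coeff n f A * walsh A \<epsilon>)
      + (1 - z) / 2 * (z ^ card (A \<inter> S) * walsh_coeff n f A * walsh A (flip i \<epsilon>))"
  proof (cases "i \<in> A")
    case True
    then have "card (A \<inter> insert i S) = Suc (card (A \<inter> S))"
      using assms A by simp
    then show ?thesis using True A by (simp add: walsh_flip field_simps)
  next
    case False
    then show ?thesis using A by (simp add: walsh_flip field_simps)
  qed
qed

text \<open>Orthogonality in the index set: the sum is the expansion of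
\<open>\<Prod>i. 1 + \<delta> i * \<epsilon> i\<close>, and a factor vanishes where \<open>\<delta>\<close> and \<open>\<epsilon>\<close> differ.\<close>

lemma sum_walsh_mult:
  assumes "\<delta> \<in> cube n" "\<epsilon> \<in> cube n"
  shows "(\<Sum>A\<in>Pow {1..n}. walsh A \<delta> * walsh A \<epsilon>) = (if \<delta> = \<epsilon> then 2 ^ n else 0)"
proof -
  have "(\<Sum>A\<in>Pow {1..n}. walsh A \<delta> * walsh A \<epsilon>)
      = (\<Prod>i\<in>{1..n}. complex_of_real (\<delta> i * \<epsilon> i) + 1)"
    by (simp add: prod_add walsh_def prod.distrib)
  also have "\<dots> = (if \<delta> = \<epsilon> then 2 ^ n else 0)"
  proof (cases "\<delta> = \<epsilon>")
    case True
    have "complex_of_real (\<delta> i * \<epsilon> i) + 1 = 2" if "i \<in> {1..n}" for i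
    proof -
      have "\<epsilon> i \<in> {-1, 1}" using that assms by (auto simp: cube_def)
      then show ?thesis using True by auto
    qed
    then have "(\<Prod>i\<in>{1..n}. complex_of_real (\<delta> i * \<epsilon> i) + 1) = (\<Prod>i\<in>{1..n}. 2)"
      by (intro prod.cong refl)
    then show ?thesis using True by simp
  next
    case False
    then obtain i where i: "i \<in> {1..n}" "\<delta> i \<noteq> \<epsilon> i"
      using assms unfolding cube_def by (meson PiE_ext)
    have "\<delta> i \<in> {-1, 1}" "\<epsilon> i \<in> {-1, 1}" using i assms by (auto simp: cube_def)
    then have "complex_of_real (\<delta> i * \<epsilon> i) + 1 = 0" using i by auto
    then show ?thesis using False i by (auto intro: prod_zero)
  qed
  finally show ?thesis .
qed

text \<open>Fourier inversion for Walsh expansions.\<close>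

lemma noise_empty:
  assumes "\<epsilon> \<in> cube n"
  shows "noise n {} z f \<epsilon> = f \<epsilon>"
proof -
  have "noise n {} z f \<epsilon> = (\<Sum>A\<in>Pow {1..n}. \<Sum>\<delta>\<in>cube n. f \<delta> / 2 ^ n * (walsh A \<delta> * walsh A \<epsilon>))"
    by (simp add: noise_def walsh_coeff_def sum_distrib_right sum_distrib_left sum_divide_distrib mult_ac)
  also have "\<dots> = (\<Sum>\<delta>\<in>cube n. f \<delta> / 2 ^ n * (\<Sum>A\<in>Pow {1..n}. walsh A \<delta> * walsh A \<epsilon>))"
    unfolding sum_distrib_left by (rule sum.swap)
  also have "\<dots> = (\<Sum>\<delta>\<in>cube n. if \<delta> = \<epsilon> then f \<epsilon> else 0)"
    by (intro sum.cong refl, subst sum_walsh_mult) (use assms in auto)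
  also have "\<dots> = f \<epsilon>" using assms by simp
  finally show ?thesis .
qed

text \<open>Tensorisation.  The norms on both sides have the same exponent, so it is enough to group the
points of the cube into the pairs \<open>{\<epsilon>, flip i \<epsilon>}\<close> and to apply the two-point inequality to
each pair, one coordinate after the other.\<close>

lemma noise_powr_contraction:
  assumes two_point: "\<And>u v. cmod ((1 + z) / 2 * u + (1 - z) / 2 * v) powr p
        + cmod ((1 + z) / 2 * v + (1 - z) / 2 * u) powr p \<le> cmod u powr p + cmod v powr p"
    and S: "S \<subseteq> {1..n}"
  shows "(\<Sum>\<epsilon>\<in>cube n. cmod (noise n S z f \<epsilon>) powr p) \<le> (\<Sum>\<epsilon>\<in>cube n. cmod (f \<epsilon>) powr p)"
proof -
  have "finite S" using S finite_subset by auto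
  then show ?thesis using S
  proof (induction S)
    case empty
    then show ?case by (simp add: noise_empty)
  next
    case (insert i S)
    let ?g = "noise n S z f" and ?h = "noise n (insert i S) z f"
    have i: "i \<in> {1..n}" using insert by simp
    have "2 * (\<Sum>\<epsilon>\<in>cube n. cmod (?h \<epsilon>) powr p)
        = (\<Sum>\<epsilon>\<in>cube n. cmod (?h \<epsilon>) powr p + cmod (?h (flip i \<epsilon>)) powr p)"
      by (simp add: sum.distrib sum_cube_flip[OF i, of "\<lambda>\<epsilon>. cmod (?h \<epsilon>) powr p"])
    also have "\<dots> \<le> (\<Sum>\<epsilon>\<in>cube n. cmod (?g \<epsilon>) powr p + cmod (?g (flip i \<epsilon>)) powr p)"
      by (intro sum_mono) (simp only: noise_insert[OF insert.hyps] flip_flip two_point)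
    also have "\<dots> = 2 * (\<Sum>\<epsilon>\<in>cube n. cmod (?g \<epsilon>) powr p)"
      by (simp add: sum.distrib sum_cube_flip[OF i, of "\<lambda>\<epsilon>. cmod (?g \<epsilon>) powr p"])
    finally show ?case using insert by simp
  qed
qed

lemma noise_sup_contraction:
  assumes z: "0 \<le> z" "z \<le> 1" and B: "\<And>\<epsilon>. \<epsilon> \<in> cube n \<Longrightarrow> cmod (f \<epsilon>) \<le> B"
    and S: "S \<subseteq> {1..n}" and "\<epsilon> \<in> cube n"
  shows "cmod (noise n S (of_real z) f \<epsilon>) \<le> B"
proof -
  have "finite S" using S finite_subset by auto
  then show ?thesis using S \<open>\<epsilon> \<in> cube n\<close>
  proof (induction S arbitrary: \<epsilon>)
    case empty
    then show ?case by (simp add: noise_empty B)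
  next
    case (insert i S)
    let ?g = "noise n S (of_real z) f"
    have "noise n (insert i S) (of_real z) f \<epsilon>
        = of_real ((1 + z) / 2) * ?g \<epsilon> + of_real ((1 - z) / 2) * ?g (flip i \<epsilon>)"
      using insert by (simp add: noise_insert)
    also have "cmod \<dots> \<le> (1 + z) / 2 * cmod (?g \<epsilon>) + (1 - z) / 2 * cmod (?g (flip i \<epsilon>))"
    proof -
      have "cmod (of_real ((1 + z) / 2)) = (1 + z) / 2" "cmod (of_real ((1 - z) / 2)) = (1 - z) / 2"
        using z by (simp_all only: norm_of_real) auto
      then show ?thesis by (intro norm_triangle_le) (simp only: norm_mult order_refl)
    qed
    also have "\<dots> \<le> (1 + z) / 2 * B + (1 - z) / 2 * B"
      using insert z by (intro add_mono mult_left_mono) (auto intro!: insert.IH flip_in_cube)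
    also have "\<dots> = B" by (simp add: field_simps)
    finally show ?case .
  qed
qed

text \<open>Pairing with a fixed \<open>g\<close> makes the vector-valued polynomial \<open>z \<mapsto> noise n {1..n} z f\<close> scalar.\<close>

lemma noise_pairing_polynomial:
  assumes "degree_at_most n d f"
  obtains P :: "complex poly" where "degree P \<le> d"
    "\<And>z. poly P z = (\<Sum>\<epsilon>\<in>cube n. noise n {1..n} z f \<epsilon> * g \<epsilon>)"
    "poly (pderiv P) 1 = (\<Sum>\<epsilon>\<in>cube n. laplacian n f \<epsilon> * g \<epsilon>)"
proof
  define b where "b = (\<lambda>A. walsh_coeff n f A * (\<Sum>\<epsilon>\<in>cube n. walsh A \<epsilon> * g \<epsilon>))"
  define P where "P = (\<Sum>A\<in>Pow {1..n}. monom (b A) (card A))"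
  have b0: "b A = 0" if "A \<subseteq> {1..n}" "card A > d" for A
    using that assms by (simp add: b_def degree_at_most_def)
  show "degree P \<le> d"
    unfolding P_def
  proof (rule degree_sum_le)
    fix A assume "A \<in> Pow {1..n}"
    then show "degree (monom (b A) (card A)) \<le> d"
      using b0[of A] degree_monom_le[of "b A" "card A"] by (cases "card A > d") auto
  qed simp
  have pairing: "(\<Sum>A\<in>Pow {1..n}. c A * b A)
      = (\<Sum>\<epsilon>\<in>cube n. (\<Sum>A\<in>Pow {1..n}. c A * walsh_coeff n f A * walsh A \<epsilon>) * g \<epsilon>)" for c
    unfolding b_def sum_distrib_left sum_distrib_right
    by (subst sum.swap) (simp add: mult_ac)
  show "poly P z = (\<Sum>\<epsilon>\<in>cube n. noise n {1..n} z f \<epsilon> * g \<epsilon>)" for z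
  proof -
    have "poly P z = (\<Sum>A\<in>Pow {1..n}. z ^ card A * b A)"
      by (simp add: P_def poly_sum poly_monom mult.commute)
    also have "\<dots> = (\<Sum>\<epsilon>\<in>cube n. noise n {1..n} z f \<epsilon> * g \<epsilon>)"
      unfolding pairing noise_def by (intro sum.cong arg_cong2[of _ _ _ _ "(*)"] refl) (auto simp: Int_absorb2)
    finally show ?thesis .
  qed
  have "poly (pderiv (\<Sum>A\<in>X. monom (b A) (card A))) 1 = (\<Sum>A\<in>X. of_nat (card A) * b A)" for X
    by (induction X rule: infinite_finite_induct) (simp_all add: pderiv_add pderiv_monom poly_monom)
  then have "poly (pderiv P) 1 = (\<Sum>A\<in>Pow {1..n}. of_nat (card A) * b A)"
    by (simp add: P_def)
  also have "\<dots> = (\<Sum>\<epsilon>\<in>cube n. laplacian n f \<epsilon> * g \<epsilon>)"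
    unfolding pairing laplacian_def ..
  finally show "poly (pderiv P) 1 = (\<Sum>\<epsilon>\<in>cube n. laplacian n f \<epsilon> * g \<epsilon>)" .
qed

section \<open>Growth of polynomials outside a lens\<close>

text \<open>The principal branch is multiplicative here because the arguments add up to less than \<open>pi\<close> in
modulus.\<close>

lemma powr_mult_right_half_plane:
  fixes a b c :: complex
  assumes "Re a \<ge> 0" "Re b > 0"
  shows "(a * b) powr c = a powr c * b powr c"
proof (cases "a = 0")
  case False
  have b0: "b \<noteq> 0" using assms by auto
  have "\<bar>Im (Ln a)\<bar> \<le> pi / 2" using Re_Ln_pos_le False assms by blast
  moreover have "\<bar>Im (Ln b)\<bar> < pi / 2" using Re_Ln_pos_lt b0 assms by blast
  ultimately have "Ln (a * b) = Ln a + Ln b"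
    using False b0 unfolding Ln_times[OF False b0] by (smt (verit) pi_gt_zero plus_complex.sel(2) field_sum_of_halves)
  then show ?thesis
    using False b0 by (simp add: powr_def distrib_left exp_add)
qed simp

text \<open>Since \<open>\<beta> \<le> 2\<close>, the power maps the half-plane onto a sector that covers each direction at most
once, except that the two edges meet on the negative axis when \<open>\<beta> = 2\<close>.\<close>

lemma powr_eq_1_right_half_plane:
  fixes \<xi> :: complex
  assumes "Re \<xi> \<ge> 0" "0 < \<beta>" "\<beta> \<le> 2" "\<xi> powr of_real \<beta> = 1"
  shows "\<xi> = 1"
proof -
  have nz: "\<xi> \<noteq> 0" using assms(4) by auto
  have e: "exp (of_real \<beta> * Ln \<xi>) = 1" using assms(4) nz by (simp add: powr_def)
  then obtain k :: int where k: "\<beta> * Re (Ln \<xi>) = 0" "\<beta> * Im (Ln \<xi>) = of_int (2 * k) * pi"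
    unfolding exp_eq_1 by auto
  have "\<bar>Im (Ln \<xi>)\<bar> \<le> pi / 2" using Re_Ln_pos_le nz assms(1) by blast
  then have "\<beta> * \<bar>Im (Ln \<xi>)\<bar> \<le> 2 * (pi / 2)"
    using assms by (intro mult_mono) auto
  then have "\<bar>of_int (2 * k) * pi\<bar> \<le> 1 * pi"
    using assms(2) k(2) by (metis abs_mult abs_of_pos mult_1 nonzero_mult_div_cancel_left times_divide_eq_right zero_neq_numeral)
  then have "\<bar>of_int (2 * k) :: real\<bar> \<le> 1"
    by (simp add: abs_mult)
  then have "k = 0" by linarith
  then have "Ln \<xi> = 0" using k assms(2) by (simp add: complex_eq_iff)
  then show ?thesis using exp_Ln[OF nz] by simp
qed

text \<open>A Bernstein-Walsh inequality for the complement of a lens with angle \<open>(2 - \<beta>) * pi\<close> at its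
corners \<open>0\<close> and \<open>1\<close>, which is a segment when \<open>\<beta> = 2\<close>.  As
\<open>\<xi>\<close> runs through the imaginary axis, \<open>1 / (1 - \<xi> powr \<beta>)\<close> runs through the boundary of the
lens, apart from the corner \<open>0\<close>, which is the limit for \<open>\<bar>\<xi>\<bar> \<rightarrow> \<infinity>\<close>.

The map \<open>\<eta> = (\<xi> - 1) / (\<xi> + 1)\<close> takes the half-plane to the unit disc and the pole \<open>\<xi> = 1\<close>
to \<open>0\<close>.  With \<open>z = 1 / (1 - \<xi> powr \<beta>)\<close>, the function \<open>G = \<eta> ^ d * poly P z\<close> has a removable
singularity at \<open>0\<close> and extends continuously to the closed disc, the point \<open>\<eta> = 1\<close> included, so
the maximum principle bounds it by its values on the circle, where its modulus is that of
\<open>poly P z\<close>.\<close>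

lemma bernstein_walsh_sector_complement:
  fixes P :: "complex poly"
  assumes deg: "degree P \<le> d" and beta: "0 < \<beta>" "\<beta> \<le> 2"
    and bd: "\<And>\<xi>. Re \<xi> = 0 \<Longrightarrow> cmod (poly P (1 / (1 - \<xi> powr of_real \<beta>))) \<le> M"
    and bd0: "cmod (poly P 0) \<le> M"
    and xi: "Re \<xi> \<ge> 0" "\<xi> \<noteq> 1"
  shows "cmod (poly P (1 / (1 - \<xi> powr of_real \<beta>))) \<le> M * (cmod (\<xi> + 1) / cmod (\<xi> - 1)) ^ d"
proof -
  \<comment> \<open>In terms of \<open>\<eta>\<close>, \<open>1 - \<xi> powr \<beta> = D \<eta> / (1 - \<eta>) powr \<beta>\<close>; so \<open>q\<close> is \<open>\<eta> * z\<close> with its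
      removable singularity at \<open>0\<close> filled in, \<open>- 2 * \<beta>\<close> being the derivative of \<open>D\<close> at \<open>0\<close>.\<close>
  define D where "D = (\<lambda>\<eta>::complex. (1 - \<eta>) powr of_real \<beta> - (1 + \<eta>) powr of_real \<beta>)"
  define h where "h = (\<lambda>\<eta>. if \<eta> = 0 then - 2 * of_real \<beta> else D \<eta> / \<eta>)"
  define q where "q = (\<lambda>\<eta>. (1 - \<eta>) powr of_real \<beta> / h \<eta>)"
  define G where "G = (\<lambda>\<eta>. \<Sum>k\<le>d. coeff P k * q \<eta> ^ k * \<eta> ^ (d - k))"

  have cayley: "q \<eta> = \<eta> / (1 - \<zeta> powr of_real \<beta>)" "D \<eta> \<noteq> 0"
    if z: "Re \<zeta> \<ge> 0" "\<zeta> \<noteq> 1" and eta: "\<eta> = (\<zeta> - 1) / (\<zeta> + 1)" for \<zeta> \<eta>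
  proof -
    have nz: "\<zeta> + 1 \<noteq> 0" using z(1) by (auto simp: complex_eq_iff)
    define c where "c = 2 / (\<zeta> + 1)"
    have "Re c = 2 * (Re \<zeta> + 1) / (cmod (\<zeta> + 1))\<^sup>2"
      unfolding c_def by (simp add: Re_divide cmod_power2)
    then have c: "Re c > 0" using z(1) nz by simp
    have m: "1 - \<eta> = c" and p: "1 + \<eta> = \<zeta> * c"
      using nz unfolding eta c_def by (auto simp: field_simps)
    have c0: "c powr of_real \<beta> \<noteq> 0" using c by auto
    have De: "D \<eta> = c powr of_real \<beta> * (1 - \<zeta> powr of_real \<beta>)"
      unfolding D_def m p powr_mult_right_half_plane[OF z(1) c] by (simp add: algebra_simps)
    have z1: "1 - \<zeta> powr of_real \<beta> \<noteq> 0"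
      using powr_eq_1_right_half_plane[OF z(1) beta] z(2) by auto
    show "D \<eta> \<noteq> 0" using De z1 c0 by simp
    have "\<eta> \<noteq> 0" using z(2) nz unfolding eta by simp
    then show "q \<eta> = \<eta> / (1 - \<zeta> powr of_real \<beta>)"
      using De z1 c0 unfolding q_def h_def m by simp
  qed

  have inverse_cayley: "Re ((1 + \<eta>) / (1 - \<eta>)) \<ge> 0" "(1 + \<eta>) / (1 - \<eta>) \<noteq> 1"
      "\<eta> = ((1 + \<eta>) / (1 - \<eta>) - 1) / ((1 + \<eta>) / (1 - \<eta>) + 1)"
      "cmod \<eta> = 1 \<Longrightarrow> Re ((1 + \<eta>) / (1 - \<eta>)) = 0"
    if "cmod \<eta> \<le> 1" "\<eta> \<noteq> 1" "\<eta> \<noteq> 0" for \<eta> :: complex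
  proof -
    have "Re ((1 + \<eta>) / (1 - \<eta>)) = (1 - (cmod \<eta>)\<^sup>2) / (cmod (1 - \<eta>))\<^sup>2"
      unfolding Re_divide cmod_power2 by (simp add: power2_eq_square algebra_simps)
    moreover have "(cmod \<eta>)\<^sup>2 \<le> 1" using that by (simp add: power_le_one)
    ultimately show "Re ((1 + \<eta>) / (1 - \<eta>)) \<ge> 0"
      "cmod \<eta> = 1 \<Longrightarrow> Re ((1 + \<eta>) / (1 - \<eta>)) = 0" by auto
    show "(1 + \<eta>) / (1 - \<eta>) \<noteq> 1" using that by (simp add: field_simps)
    have "1 - \<eta> \<noteq> 0" using that by simp
    then have "(1 + \<eta>) / (1 - \<eta>) - 1 = 2 * \<eta> / (1 - \<eta>)" "(1 + \<eta>) / (1 - \<eta>) + 1 = 2 / (1 - \<eta>)"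
      by (auto simp: field_simps)
    then show "\<eta> = ((1 + \<eta>) / (1 - \<eta>) - 1) / ((1 + \<eta>) / (1 - \<eta>) + 1)"
      using \<open>1 - \<eta> \<noteq> 0\<close> by simp
  qed

  have Dnz: "D \<eta> \<noteq> 0" if "cmod \<eta> \<le> 1" "\<eta> \<noteq> 0" for \<eta>
  proof (cases "\<eta> = 1")
    case True
    then show ?thesis by (simp add: D_def)
  next
    case False
    show ?thesis
      by (rule cayley(2)[OF inverse_cayley(1,2,3)]) (use that False in auto)
  qed
  have hnz: "h \<eta> \<noteq> 0" if "cmod \<eta> \<le> 1" for \<eta>
    using that Dnz beta by (auto simp: h_def)

  have half: "1 - \<eta> \<notin> \<real>\<^sub>\<le>\<^sub>0" "1 + \<eta> \<notin> \<real>\<^sub>\<le>\<^sub>0" if "\<eta> \<in> ball 0 1" for \<eta> :: complex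
    using that abs_Re_le_cmod[of \<eta>] by (auto simp: complex_nonpos_Reals_iff)
  have Dhol: "D holomorphic_on ball 0 1"
    unfolding D_def by (intro holomorphic_intros) (use half in auto)
  have D0: "D 0 = 0" by (simp add: D_def)
  have "(D has_field_derivative (- 2 * of_real \<beta>)) (at 0)"
    unfolding D_def by (rule derivative_eq_intros refl | simp)+
  then have dD: "deriv D 0 = - 2 * of_real \<beta>" by (rule DERIV_imp_deriv)
  have hhol: "h holomorphic_on ball 0 1"
    by (rule pole_theorem_open_0[OF Dhol, where a = 0]) (auto simp: h_def dD D0)
  have closed_half: "0 \<le> 1 - Re \<eta>" "0 \<le> 1 + Re \<eta>" if "cmod \<eta> \<le> 1" for \<eta> :: complex
    using that abs_Re_le_cmod[of \<eta>] by auto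
  have Dcont: "continuous_on (cball 0 1) D"
    unfolding D_def
  proof (intro continuous_intros)
    show "cball 0 1 \<subseteq> {z::complex. 0 \<le> Re (1 - z) \<or> Im (1 - z) \<noteq> 0}"
      "cball 0 1 \<subseteq> {z::complex. 0 \<le> Re (1 + z) \<or> Im (1 + z) \<noteq> 0}"
      using closed_half by auto
  qed (use beta in auto)
  have "continuous_on (cball 0 1) (\<lambda>\<eta>::complex. (1 - \<eta>) powr of_real \<beta>)"
  proof (intro continuous_intros)
    show "cball 0 1 \<subseteq> {z::complex. 0 \<le> Re (1 - z) \<or> Im (1 - z) \<noteq> 0}"
      using closed_half by auto
  qed (use beta in auto)
  moreover have hcont: "continuous_on (cball 0 1) h"
    unfolding continuous_on_eq_continuous_within
  proof
    fix x :: complex assume x: "x \<in> cball 0 1"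
    show "continuous (at x within cball 0 1) h"
    proof (cases "x = 0")
      case True
      have "continuous_on (ball 0 1) h" using hhol by (rule holomorphic_on_imp_continuous_on)
      then have "isCont h x" using True by (simp add: continuous_on_eq_continuous_at)
      then show ?thesis by (rule continuous_at_imp_continuous_at_within)
    next
      case False
      have "continuous (at x within cball 0 1) (\<lambda>y. D y / y)"
        using Dcont x False by (intro continuous_intros) (auto simp: continuous_on_eq_continuous_within)
      then show ?thesis
        by (rule continuous_transform_within[where \<delta> = "cmod x"])
          (use False x in \<open>auto simp: h_def dist_norm\<close>)
    qed
  qed
  ultimately have qcont: "continuous_on (cball 0 1) q"
    unfolding q_def by (intro continuous_on_divide) (use hnz in auto)
  have qhol: "q holomorphic_on ball 0 1"
    unfolding q_def by (intro holomorphic_intros hhol) (use half hnz in auto)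

  have G_eq: "G \<eta> = \<eta> ^ d * poly P z" if "q \<eta> = \<eta> * z" for \<eta> z
  proof -
    have "poly P z = (\<Sum>k\<le>d. coeff P k * z ^ k)"
      unfolding poly_altdef
      by (rule sum.mono_neutral_left) (use deg in \<open>auto simp: coeff_eq_0\<close>)
    moreover have "\<eta> ^ d = \<eta> ^ k * \<eta> ^ (d - k)" if "k \<le> d" for k
      using that by (simp flip: power_add)
    ultimately show ?thesis
      unfolding G_def that by (simp add: sum_distrib_left power_mult_distrib mult_ac)
  qed

  have "cmod (G \<eta>) \<le> M" if "\<eta> \<in> cball 0 1" for \<eta>
  proof (rule maximum_modulus_frontier[of G "cball 0 1"])
    show "G holomorphic_on interior (cball 0 1)"
      unfolding G_def using qhol by (auto intro!: holomorphic_intros)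
    show "continuous_on (closure (cball 0 1)) G"
      unfolding G_def using qcont by (auto intro!: continuous_intros)
    show "bounded (cball (0::complex) 1)" by simp
    show "\<eta> \<in> cball 0 1" by fact
    fix z :: complex assume "z \<in> frontier (cball 0 1)"
    then have z: "cmod z = 1" by (simp add: sphere_def)
    show "cmod (G z) \<le> M"
    proof (cases "z = 1")
      case True
      then have "q z = z * 0" by (simp add: q_def)
      from G_eq[OF this] show ?thesis using True bd0 by simp
    next
      case False
      let ?\<zeta> = "(1 + z) / (1 - z)"
      have z0: "z \<noteq> 0" using z by auto
      have "q z = z * (1 / (1 - ?\<zeta> powr of_real \<beta>))"
        using cayley(1)[OF inverse_cayley(1,2,3)[of z]] z z0 False by simp
      from G_eq[OF this] show ?thesis
        using z bd[OF inverse_cayley(4)[of z]] z0 False by (simp add: norm_mult norm_power)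
    qed
  qed
  moreover define \<eta> where "\<eta> = (\<xi> - 1) / (\<xi> + 1)"
  moreover have "(cmod (\<xi> - 1))\<^sup>2 \<le> (cmod (\<xi> + 1))\<^sup>2"
    unfolding cmod_power2 using xi(1) by (simp add: power2_eq_square algebra_simps)
  then have le: "cmod (\<xi> - 1) \<le> cmod (\<xi> + 1)" by (rule power2_le_imp_le) simp
  have pos: "cmod (\<xi> - 1) > 0" "cmod (\<xi> + 1) > 0"
    using xi by (auto simp: complex_eq_iff)
  ultimately have "cmod (G \<eta>) \<le> M"
    using le by (simp add: norm_divide)
  moreover have "q \<eta> = \<eta> * (1 / (1 - \<xi> powr of_real \<beta>))"
    using cayley(1)[OF xi \<eta>_def] by simp
  note G_eq[OF this]
  ultimately have "cmod (\<xi> - 1) ^ d * cmod (poly P (1 / (1 - \<xi> powr of_real \<beta>))) \<le> M * cmod (\<xi> + 1) ^ d"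
    using pos by (simp add: norm_mult norm_power norm_divide \<eta>_def power_divide field_simps)
  then show ?thesis
    using pos by (simp add: power_divide field_simps)
qed

text \<open>The quadratic term is essential for \<open>ratio_power_le_9\<close>: with \<open>u\<close> as chosen there, the linear
bound \<open>1 + d * u\<close> falls below \<open>(d + 2) / d\<close> for \<open>d > 2\<close>.\<close>

lemma Bernoulli_second_order:
  fixes u :: real
  assumes "u \<ge> 0"
  shows "1 + real d * u + real d * (real d - 1) / 2 * u\<^sup>2 \<le> (1 + u) ^ d"
proof (induction d)
  case (Suc d)
  have "0 \<le> real d * (real d - 1)" by (cases d) auto
  then have "0 \<le> real d * (real d - 1) / 2 * u\<^sup>2 * u" using assms by simp
  then have "1 + real (Suc d) * u + real (Suc d) * (real (Suc d) - 1) / 2 * u\<^sup>2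
      \<le> (1 + u) * (1 + real d * u + real d * (real d - 1) / 2 * u\<^sup>2)"
    by (simp add: power2_eq_square field_simps)
  also have "\<dots> \<le> (1 + u) * (1 + u) ^ d"
    using Suc.IH assms by (intro mult_left_mono) auto
  finally show ?case by simp
qed simp

text \<open>The sequence \<open>((d + 1) / (d - 1)) ^ d\<close> decreases from its value \<open>9\<close> at \<open>d = 2\<close> to its limit
\<open>exp 2\<close>; the induction step shows that it is nonincreasing.\<close>

lemma ratio_power_le_9:
  fixes d :: nat
  assumes "d \<ge> 2"
  shows "((1 + 1 / real d) / (1 - 1 / real d)) ^ d \<le> 9"
proof -
  have "((real d + 1) / (real d - 1)) ^ d \<le> 9"
    using assms
  proof (induction d rule: dec_induct)
    case base
    show ?case by (simp add: power2_eq_square)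
  next
    case (step d)
    define x where "x = real d"
    have x: "x \<ge> 2" using step by (simp add: x_def)
    define r where "r = (x + 1) / (x - 1)"
    define u where "u = 2 / ((x + 2) * (x - 1))"
    have u: "u \<ge> 0" using x by (simp add: u_def)
    have "(x + 2) * (x - 1) \<noteq> 0" using x by simp
    then have "1 + u = ((x + 2) * (x - 1) + 2) / ((x + 2) * (x - 1))"
      by (simp add: u_def field_simps)
    also have "(x + 2) * (x - 1) + 2 = x * (x + 1)" by (simp add: algebra_simps)
    finally have eq: "r = (x + 2) / x * (1 + u)"
      using x by (simp add: r_def)
    have "(x + 2) / x \<le> 1 + real d * u + real d * (real d - 1) / 2 * u\<^sup>2"
    proof -
      have *: "real d * (real d - 1) / 2 * u\<^sup>2 = x * u / (x + 2)"
        using x by (simp add: u_def power2_eq_square divide_simps flip: x_def)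
      have "x\<^sup>2 * (x + 3) - (x + 2)\<^sup>2 * (x - 1) = 4"
        by (simp add: power2_eq_square algebra_simps)
      then have "2 / x \<le> x * u + x * u / (x + 2)"
        using x by (simp add: u_def divide_simps power2_eq_square mult_ac) (simp add: algebra_simps)
      then show ?thesis unfolding * using x by (simp add: add_divide_distrib flip: x_def)
    qed
    also have "\<dots> \<le> (1 + u) ^ d"
      using u by (rule Bernoulli_second_order)
    finally have "((x + 2) / x) ^ Suc d \<le> ((x + 2) / x) ^ d * (1 + u) ^ d"
      unfolding power_Suc2 using x by (intro mult_left_mono) auto
    also have "\<dots> = r ^ d" unfolding eq by (rule power_mult_distrib[symmetric])
    also have "\<dots> \<le> 9" using step.IH by (simp add: r_def x_def)
    finally show ?case by (simp add: x_def algebra_simps)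
  qed
  also have "(real d + 1) / (real d - 1) = (1 + 1 / real d) / (1 - 1 / real d)"
    using assms by (simp add: field_simps)
  finally show ?thesis .
qed

lemma powr_of_real_rcis:
  assumes "r > 0" "\<bar>a\<bar> < pi"
  shows "rcis r a powr of_real \<beta> = rcis (r powr \<beta>) (\<beta> * a)"
proof -
  have "rcis r a = exp (of_real (ln r) + \<i> * of_real a)"
    using assms by (simp add: rcis_def exp_add cis_conv_exp exp_of_real)
  moreover have "Ln (exp (of_real (ln r) + \<i> * of_real a)) = of_real (ln r) + \<i> * of_real a"
    using assms by (intro Ln_exp) auto
  ultimately have "rcis r a powr of_real \<beta> = exp (of_real (\<beta> * ln r) + \<i> * of_real (\<beta> * a))"
    by (simp add: powr_def algebra_simps)
  also have "\<dots> = rcis (r powr \<beta>) (\<beta> * a)"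
    using assms by (simp add: rcis_def exp_add cis_conv_exp powr_def flip: exp_of_real)
  finally show ?thesis .
qed

section \<open>Markov's inequality at the corner of a lens\<close>

text \<open>The hypothesis says that \<open>P\<close> is bounded by \<open>M\<close> on the lens with corners \<open>0\<close> and \<open>1\<close>.  In the
coordinate \<open>w\<close> with \<open>z = 1 / (1 - w)\<close> the corner \<open>1\<close> becomes \<open>w = 0\<close>, the lens becomes the
sector \<open>\<bar>arg (- w)\<bar> \<le> \<phi>\<close>, and \<open>dz / dw = 1\<close> at \<open>w = 0\<close>.  Cauchy's estimate on a circle of
radius \<open>d powr (- \<beta>)\<close> is balanced: on a larger circle the polynomial may grow, on a smaller one
the division by the radius loses.\<close>

lemma markov_lens_corner:
  fixes P :: "complex poly"
  assumes deg: "degree P \<le> d" and d: "1 \<le> d" and phi: "0 \<le> \<phi>" "\<phi> \<le> pi / 2"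
    and bd: "\<And>\<rho> \<psi>. \<rho> \<ge> 0 \<Longrightarrow> \<bar>\<psi>\<bar> \<le> \<phi> \<Longrightarrow> cmod (poly P (1 / (1 + rcis \<rho> \<psi>))) \<le> M"
  shows "cmod (poly (pderiv P) 1) \<le> 10 * real d powr (2 - 2 * \<phi> / pi) * M"
proof (cases "d = 1")
  case True
  obtain a Q where PQ: "P = pCons a Q" by (rule pCons_cases)
  have "degree Q = 0"
    using deg True by (cases "Q = 0") (auto simp: PQ)
  then obtain b where P: "P = [:a, b:]"
    using PQ by (auto elim: degree_eq_zeroE)
  \<comment> \<open>An affine function is controlled by any two points of the segment; \<open>1\<close> and \<open>1 / 5\<close>,
      that is \<open>\<mu> = 0\<close> and \<open>\<mu> = 4\<close>, are far enough apart.\<close>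
  have "cmod (a + b) \<le> M" using bd[of 0 0] phi by (simp add: P)
  moreover have "cmod (a + b / 5) \<le> M" using bd[of 4 0] phi by (simp add: P rcis_def)
  moreover have "b = 5 / 4 * ((a + b) - (a + b / 5))" by simp
  then have "cmod b = 5 / 4 * cmod ((a + b) - (a + b / 5))"
    by (simp add: norm_mult norm_divide)
  moreover have "cmod ((a + b) - (a + b / 5)) \<le> cmod (a + b) + cmod (a + b / 5)"
    by (rule norm_triangle_ineq4)
  ultimately have "cmod b \<le> 10 * M"
    using norm_ge_zero[of "a + b"] by linarith
  then show ?thesis using True by (simp add: P pderiv_pCons)
next
  case False
  with d have d2: "d \<ge> 2" by simp
  define \<beta> where "\<beta> = 2 - 2 * \<phi> / pi"
  have beta: "1 \<le> \<beta>" "\<beta> \<le> 2" using phi by (auto simp: \<beta>_def field_simps)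
  have beta_phi: "\<beta> * (pi / 2) = pi - \<phi>" by (simp add: \<beta>_def field_simps)
  have M: "M \<ge> 0" using order_trans[OF norm_ge_zero bd[of 0 0]] phi by simp

  \<comment> \<open>The corner \<open>0\<close> is only a limit of the points in the hypothesis.\<close>
  have bd0: "cmod (poly P 0) \<le> M"
  proof -
    have "((\<lambda>n. cmod (poly P (1 / (1 + rcis (real n) 0)))) \<longlongrightarrow> cmod (poly P 0)) sequentially"
    proof (intro tendsto_intros)
      have "(\<lambda>n. of_real (1 / (1 + real n)) :: complex) \<longlonglongrightarrow> of_real 0"
        by (intro tendsto_intros) real_asymp
      then show "(\<lambda>n. 1 / (1 + rcis (real n) 0)) \<longlonglongrightarrow> 0"
        by (simp add: rcis_def)
    qed
    then show ?thesis
      by (rule LIMSEQ_le_const2) (intro exI allI impI bd, use phi in auto)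
  qed

  \<comment> \<open>As \<open>\<beta> * pi / 2 = pi - \<phi>\<close>, the two halves of the imaginary axis go to the rays \<open>\<bar>arg w\<bar> = pi - \<phi>\<close>,
      on which \<open>- w\<close> has argument \<open>- \<phi>\<close> or \<open>\<phi>\<close>: the edges of the sector in the hypothesis.\<close>
  have bd_imag: "cmod (poly P (1 / (1 - \<xi> powr of_real \<beta>))) \<le> M" if "Re \<xi> = 0" for \<xi>
  proof (cases "\<xi> = 0")
    case True
    then show ?thesis using bd[of 0 0] phi by simp
  next
    case False
    define t where "t = Im \<xi>"
    have t: "t \<noteq> 0" "\<xi> = rcis \<bar>t\<bar> (sgn t * (pi / 2))"
      using False that by (auto simp: t_def complex_eq_iff rcis_def sgn_if)
    have "\<xi> powr of_real \<beta> = rcis (\<bar>t\<bar> powr \<beta>) (\<beta> * (sgn t * (pi / 2)))"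
      unfolding t(2) using t(1) by (intro powr_of_real_rcis) (auto simp: abs_mult)
    also have "\<beta> * (sgn t * (pi / 2)) = sgn t * (pi - \<phi>)"
      unfolding beta_phi[symmetric] by simp
    also have "rcis (\<bar>t\<bar> powr \<beta>) (sgn t * (pi - \<phi>)) = - rcis (\<bar>t\<bar> powr \<beta>) (- sgn t * \<phi>)"
      using t(1) by (auto simp: sgn_if rcis_def complex_eq_iff cos_diff sin_diff)
    finally have eq: "1 - \<xi> powr of_real \<beta> = 1 + rcis (\<bar>t\<bar> powr \<beta>) (- sgn t * \<phi>)" by simp
    show ?thesis
      unfolding eq by (rule bd) (use phi t(1) in \<open>auto simp: abs_mult abs_sgn_eq\<close>)
  qed

  \<comment> \<open>With \<open>\<bar>\<xi>\<bar> = 1 / d\<close> the growth factor is \<open>((1 + 1/d) / (1 - 1/d)) ^ d\<close>, bounded in \<open>d\<close>.\<close>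
  define s where "s = 1 / real d"
  have s: "0 < s" "s < 1" using d2 by (auto simp: s_def)
  define \<rho> where "\<rho> = s powr \<beta>"
  have rho: "0 < \<rho>" "\<rho> < 1" using s beta powr_less_mono2[of \<beta> s 1] by (auto simp: \<rho>_def)
  define F where "F = (\<lambda>w. poly P (1 / (1 - w)))"

  have circle: "cmod (F w) \<le> 9 * M" if w: "cmod w = \<rho>" for w
  proof (cases "\<bar>Arg w\<bar> \<le> pi - \<phi>")
    case True
    \<comment> \<open>Here \<open>w\<close> lies outside the lens or on its boundary, and \<open>\<xi> = w powr (1 / \<beta>)\<close>.\<close>
    define a where "a = Arg w / \<beta>"
    have wa: "w = rcis \<rho> (\<beta> * a)" using beta w by (simp add: a_def rcis_cmod_Arg flip: w)
    have a: "\<bar>a\<bar> \<le> pi / 2"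
      using True beta unfolding beta_phi[symmetric] by (simp add: a_def abs_mult field_simps)
    define \<xi> where "\<xi> = rcis s a"
    have xi: "\<xi> powr of_real \<beta> = w"
      unfolding \<xi>_def wa \<rho>_def using s a pi_gt_zero by (intro powr_of_real_rcis) linarith+
    have cxi: "cmod \<xi> = s" using s by (simp add: \<xi>_def)
    have "Re \<xi> \<ge> 0"
      unfolding \<xi>_def using s a cos_ge_zero[of a] by (auto simp: rcis_def)
    then have "cmod (F w) \<le> M * (cmod (\<xi> + 1) / cmod (\<xi> - 1)) ^ d"
      unfolding F_def xi[symmetric]
      by (intro bernstein_walsh_sector_complement[OF deg _ _ bd_imag bd0]) (use beta s cxi in auto)
    also have "\<dots> \<le> M * ((1 + s) / (1 - s)) ^ d"
    proof (intro mult_left_mono power_mono frac_le M)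
      show "cmod (\<xi> + 1) \<le> 1 + s" using norm_triangle_ineq[of \<xi> 1] cxi by simp
      show "1 - s \<le> cmod (\<xi> - 1)" using norm_triangle_ineq2[of 1 \<xi>] cxi by (simp add: norm_minus_commute)
    qed (use s in auto)
    also have "\<dots> \<le> M * 9"
      using ratio_power_le_9[OF d2] M by (intro mult_left_mono) (auto simp: s_def)
    finally show ?thesis by simp
  next
    case False
    \<comment> \<open>Here \<open>w\<close> lies in the lens itself, and \<open>\<psi>\<close> is the argument of \<open>- w\<close>.\<close>
    define \<psi> where "\<psi> = Arg w - sgn (Arg w) * pi"
    have psi: "\<bar>\<psi>\<bar> \<le> \<phi>"
      using False Arg_bounded[of w] phi by (auto simp: \<psi>_def sgn_if)
    have "Arg w \<noteq> 0" using False phi by auto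
    then have "- w = rcis \<rho> \<psi>"
      using rcis_cmod_Arg[of w] unfolding w
      by (auto simp: \<psi>_def rcis_def sgn_if complex_eq_iff cos_diff sin_diff cos_add sin_add)
    then have "F w = poly P (1 / (1 + rcis \<rho> \<psi>))" by (simp add: F_def flip: \<open>- w = rcis \<rho> \<psi>\<close>)
    then show ?thesis using bd[of \<rho> \<psi>] rho psi M by simp
  qed

  have nz: "1 - w \<noteq> 0" if "w \<in> cball 0 \<rho>" for w :: complex
    using that rho by auto
  have dF: "deriv F 0 = poly (pderiv P) 1"
  proof (rule DERIV_imp_deriv)
    have "((\<lambda>w. 1 / (1 - w)) has_field_derivative 1) (at (0::complex))"
      by (rule derivative_eq_intros refl | simp)+
    from DERIV_chain2[OF poly_DERIV this, of P] show "(F has_field_derivative poly (pderiv P) 1) (at 0)"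
      by (simp add: F_def)
  qed
  have hol: "F holomorphic_on cball 0 \<rho>"
    unfolding F_def poly_altdef by (intro holomorphic_intros) (use nz in auto)
  have "cmod ((deriv ^^ 1) F 0) \<le> fact 1 * (9 * M) / \<rho> ^ 1"
  proof (rule Cauchy_inequality)
    show "F holomorphic_on ball 0 \<rho>" using hol holomorphic_on_subset ball_subset_cball by blast
    show "continuous_on (cball 0 \<rho>) F" using hol by (rule holomorphic_on_imp_continuous_on)
  qed (use rho circle in auto)
  then have "cmod (poly (pderiv P) 1) \<le> 9 * M / \<rho>" by (simp add: dF)
  also have "\<dots> = 9 * real d powr \<beta> * M"
    using d2 by (simp add: \<rho>_def s_def powr_divide)
  also have "\<dots> \<le> 10 * real d powr \<beta> * M"
    using M by (intro mult_right_mono) auto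
  finally show ?thesis by (simp add: \<beta>_def)
qed

section \<open>The Laplacian of a function of low degree\<close>

lemma laplacian_pairing_bound:
  assumes deg: "degree_at_most n d f" and d: "1 \<le> d" and phi: "0 \<le> \<phi>" "\<phi> \<le> pi / 2"
    and bd: "\<And>\<rho> \<psi>. \<rho> \<ge> 0 \<Longrightarrow> \<bar>\<psi>\<bar> \<le> \<phi> \<Longrightarrow>
      cmod (\<Sum>\<epsilon>\<in>cube n. noise n {1..n} (1 / (1 + rcis \<rho> \<psi>)) f \<epsilon> * g \<epsilon>) \<le> M"
  shows "cmod (\<Sum>\<epsilon>\<in>cube n. laplacian n f \<epsilon> * g \<epsilon>) \<le> 10 * real d powr (2 - 2 * \<phi> / pi) * M"
proof -
  obtain P :: "complex poly" where P: "degree P \<le> d"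
    "\<And>z. poly P z = (\<Sum>\<epsilon>\<in>cube n. noise n {1..n} z f \<epsilon> * g \<epsilon>)"
    "poly (pderiv P) 1 = (\<Sum>\<epsilon>\<in>cube n. laplacian n f \<epsilon> * g \<epsilon>)"
    using noise_pairing_polynomial[OF deg] by metis
  from markov_lens_corner[OF P(1) d phi, of M] bd show ?thesis
    unfolding P(2,3) by blast
qed

text \<open>Here \<open>theta \<infinity> = 0\<close>: the lens is the segment from \<open>0\<close> to \<open>1\<close>, where each coordinate
operator is an average.  The norming functionals are point evaluations.\<close>

lemma laplacian_bound_sup:
  assumes deg: "degree_at_most n d f" and d: "1 \<le> d"
  shows "cube_norm n \<infinity> (laplacian n f) \<le> 10 * real d powr 2 * cube_norm n \<infinity> f"
proof -
  define B where "B = cube_norm n \<infinity> f"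
  have B: "cmod (f \<epsilon>) \<le> B" if "\<epsilon> \<in> cube n" for \<epsilon>
    using that by (simp add: B_def cube_norm_def)
  have "cmod (laplacian n f \<epsilon>) \<le> 10 * real d powr 2 * B" if e: "\<epsilon> \<in> cube n" for \<epsilon>
  proof -
    have ev: "(\<Sum>\<delta>\<in>cube n. h \<delta> * (if \<delta> = \<epsilon> then 1 else 0)) = h \<epsilon>" for h :: "_ \<Rightarrow> complex"
      using e by (simp add: if_distrib[of "\<lambda>x. _ * x"] cong: if_cong)
    have "cmod (\<Sum>\<delta>\<in>cube n. laplacian n f \<delta> * (if \<delta> = \<epsilon> then 1 else 0)) \<le> 10 * real d powr (2 - 2 * 0 / pi) * B"
    proof (rule laplacian_pairing_bound[OF deg d])
      fix \<rho> \<psi> :: real assume "0 \<le> \<rho>" "\<bar>\<psi>\<bar> \<le> 0"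
      then have "1 / (1 + rcis \<rho> \<psi>) = of_real (1 / (1 + \<rho>))" by (simp add: rcis_def)
      then show "cmod (\<Sum>\<delta>\<in>cube n. noise n {1..n} (1 / (1 + rcis \<rho> \<psi>)) f \<delta> * (if \<delta> = \<epsilon> then 1 else 0)) \<le> B"
        unfolding ev using \<open>0 \<le> \<rho>\<close> B e by (simp only:) (intro noise_sup_contraction, auto)
    qed auto
    then show ?thesis unfolding ev by simp
  qed
  then show ?thesis
    unfolding B_def[symmetric] by (simp add: cube_norm_def[of n \<infinity> "laplacian n f"])
qed

text \<open>The Laplacian \<open>h\<close> of \<open>f\<close> is paired with \<open>conj_power p h\<close>, which turns the pairing into
\<open>\<Sum> \<bar>h\<bar> powr p\<close>, while Hoelder's inequality and the contraction property bound the pairing of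
the same functional with each \<open>noise n {1..n} z f\<close>, \<open>z\<close> in the lens.\<close>

lemma laplacian_bound_powr:
  fixes p :: real
  assumes deg: "degree_at_most n d f" and d: "1 \<le> d" and p: "1 \<le> p"
  shows "(\<Sum>\<epsilon>\<in>cube n. cmod (laplacian n f \<epsilon>) powr p) powr (1 / p)
       \<le> 10 * real d powr (2 - 2 * arcsin (2 * sqrt (p - 1) / p) / pi)
           * (\<Sum>\<epsilon>\<in>cube n. cmod (f \<epsilon>) powr p) powr (1 / p)"
proof -
  define \<phi> where "\<phi> = arcsin (2 * sqrt (p - 1) / p)"
  define C where "C = 10 * real d powr (2 - 2 * \<phi> / pi)"
  let ?h = "laplacian n f"
  define H where "H = (\<Sum>\<epsilon>\<in>cube n. cmod (?h \<epsilon>) powr p)"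
  define F where "F = (\<Sum>\<epsilon>\<in>cube n. cmod (f \<epsilon>) powr p)"
  have H0: "H \<ge> 0" by (simp add: H_def sum_nonneg)
  have "0 \<le> (p - 2)\<^sup>2" by simp
  then have "4 * (p - 1) \<le> p\<^sup>2" by (simp add: power2_eq_square algebra_simps)
  then have "(2 * sqrt (p - 1))\<^sup>2 \<le> p\<^sup>2" using p by (simp add: power_mult_distrib)
  then have "2 * sqrt (p - 1) \<le> p" by (rule power2_le_imp_le) (use p in simp)
  then have x: "0 \<le> 2 * sqrt (p - 1) / p" "2 * sqrt (p - 1) / p \<le> 1" using p by auto
  have phi: "0 \<le> \<phi>" "\<phi> \<le> pi / 2"
    unfolding \<phi>_def using x arcsin_le_arcsin[of 0 "2 * sqrt (p - 1) / p"] arcsin_ubound by auto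
  have "of_real H = (\<Sum>\<epsilon>\<in>cube n. ?h \<epsilon> * conj_power p (?h \<epsilon>))"
    by (simp add: H_def mult_conj_power)
  then have "H = cmod (\<Sum>\<epsilon>\<in>cube n. ?h \<epsilon> * conj_power p (?h \<epsilon>))"
    using H0 by (metis norm_of_real abs_of_nonneg)
  also have "\<dots> \<le> 10 * real d powr (2 - 2 * \<phi> / pi) * (F powr (1 / p) * H powr (1 - 1 / p))"
  proof (rule laplacian_pairing_bound[OF deg d phi])
    fix \<rho> \<psi> :: real assume rp: "0 \<le> \<rho>" "\<bar>\<psi>\<bar> \<le> \<phi>"
    let ?g = "noise n {1..n} (1 / (1 + rcis \<rho> \<psi>)) f"
    have "cmod (\<Sum>\<epsilon>\<in>cube n. ?g \<epsilon> * conj_power p (?h \<epsilon>))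
        \<le> (\<Sum>\<epsilon>\<in>cube n. cmod (?g \<epsilon>) * cmod (?h \<epsilon>) powr (p - 1))"
      by (rule order_trans[OF norm_sum]) (simp add: norm_mult cmod_conj_power)
    also have "\<dots> \<le> (\<Sum>\<epsilon>\<in>cube n. cmod (?g \<epsilon>) powr p) powr (1 / p) * H powr (1 - 1 / p)"
      unfolding H_def using p by (intro Holder_sum) auto
    also have "\<dots> \<le> F powr (1 / p) * H powr (1 - 1 / p)"
      unfolding F_def using p rp
      by (intro mult_right_mono powr_mono2 noise_powr_contraction two_point_contraction_lens)
        (auto simp: \<phi>_def intro: sum_nonneg)
    finally show "cmod (\<Sum>\<epsilon>\<in>cube n. ?g \<epsilon> * conj_power p (?h \<epsilon>)) \<le> F powr (1 / p) * H powr (1 - 1 / p)" .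
  qed
  finally have le: "H \<le> C * F powr (1 / p) * H powr (1 - 1 / p)" by (simp add: C_def mult_ac)
  have "H powr (1 / p) \<le> C * F powr (1 / p)"
  proof (cases "H = 0")
    case False
    then have "H powr (1 / p) * H powr (1 - 1 / p) = H" using H0 by (simp flip: powr_add)
    then have "H powr (1 / p) * H powr (1 - 1 / p) \<le> C * F powr (1 / p) * H powr (1 - 1 / p)"
      using le by simp
    then show ?thesis using False H0 by simp
  qed (simp add: C_def)
  then show ?thesis unfolding H_def F_def C_def \<phi>_def .
qed

theorem theorem14:
  fixes p :: ereal and n d :: nat and f :: "(nat \<Rightarrow> real) \<Rightarrow> complex"
  assumes "1 \<le> p"
    and "1 \<le> d" and "d \<le> n"
    and "degree_at_most n d f"
  shows "cube_norm n p (laplacian n f)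
           \<le> 10 * real d powr (2 - theta p / pi) * cube_norm n p f"
proof (cases "p = \<infinity>")
  case True
  then show ?thesis using laplacian_bound_sup[OF assms(4,2)] by (simp add: theta_def)
next
  case False
  then obtain r where r: "p = ereal r" "1 \<le> r" using assms(1) by (cases p) auto
  show ?thesis
    using laplacian_bound_powr[OF assms(4,2) r(2)]
    by (simp add: r(1) cube_norm_def theta_def powr_divide sum_nonneg divide_right_mono)
qed

end
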